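(* Let $A\subseteq B$ be a ring extension. For all rings $C$ with $A\subseteq C\subseteq B$ such that $C$ is subintegral over $A$, the map $\varphi(A,C,B):\mathcal{I}(A,B)\to\mathcal{I}(C,B)$, $I\mapsto IC$, is surjective.
   Context: All rings are commutative with $1$ and ring homomorphisms are unitary. For a ring extension $A\subseteq B$, an $A$-submodule $I$ of $B$ is invertible if there is an $A$-submodule $J$ of $B$ with $IJ=A$; $\mathcal{I}(A,B)$ is the group, under multiplication, of invertible $A$-submodules of $B$. An extension $A\subseteq C$ is elementary subintegral if $C=A[c]$ for some $c\in C$ with $c^2,c^3\in A$. An extension $A\subseteq C$ is subintegral if for each $c\in C$ there is a finite sequence of ring extensions $A=C_0\subseteq C_1\subseteq\cdots\subseteq C_r\subseteq C$ with $c\in C_r$ and each $C_{i-1}\subseteq C_i$ elementary subintegral ($1\le i\le r$). *)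

theory Defs
  imports
    "HOL-Algebra.Module"
    "HOL-Algebra.Ideal_Product"
    "HOL-Algebra.Generated_Rings"
begin

text \<open>All rings of an extension are subrings (with the same unit) of one ambient commutative
  ring \<open>R\<close>, given by their carrier sets.\<close>

definition ring_extension :: "('a, 'b) ring_scheme \<Rightarrow> 'a set \<Rightarrow> 'a set \<Rightarrow> bool" where
  "ring_extension R A C \<longleftrightarrow> subring A R \<and> subring C R \<and> A \<subseteq> C"

definition elementary_subintegral :: "('a, 'b) ring_scheme \<Rightarrow> 'a set \<Rightarrow> 'a set \<Rightarrow> bool" where
  "elementary_subintegral R A C \<longleftrightarrow>
     ring_extension R A C \<and>
     (\<exists>c\<in>C. C = generate_ring R (insert c A) \<and>
            c [^]\<^bsub>R\<^esub> (2::nat) \<in> A \<and> c [^]\<^bsub>R\<^esub> (3::nat) \<in> A)"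

definition subintegral :: "('a, 'b) ring_scheme \<Rightarrow> 'a set \<Rightarrow> 'a set \<Rightarrow> bool" where
  "subintegral R A C \<longleftrightarrow>
     ring_extension R A C \<and>
     (\<forall>c\<in>C. \<exists>(r::nat) (D :: nat \<Rightarrow> 'a set).
        D 0 = A \<and> (\<forall>i\<in>{1..r}. elementary_subintegral R (D (i - 1)) (D i)) \<and>
        ring_extension R (D r) C \<and> c \<in> D r)"

text \<open>A ring regarded as a module with scalar multiplication its own product; over a subring
  \<open>A\<close> the scalars are cut down by taking \<open>R\<lparr>carrier := A\<rparr>\<close> as the base ring.\<close>

definition module_of_ring :: "('a, 'b) ring_scheme \<Rightarrow> ('a, 'a) module" where
  "module_of_ring R = \<lparr>carrier = carrier R, mult = mult R, one = one R,
     zero = zero R, add = add R, smult = mult R\<rparr>"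

abbreviation submodule_over :: "'a set \<Rightarrow> ('a, 'b) ring_scheme \<Rightarrow> 'a set \<Rightarrow> bool" where
  "submodule_over A R I \<equiv> submodule I (R\<lparr>carrier := A\<rparr>) (module_of_ring R)"

text \<open>The constant \<open>ideal_prod\<close> of the library forms all finite nonempty sums of products
  \<open>i \<otimes> j\<close> and does not require its arguments to be ideals, so on submodules of \<open>R\<close> it is the
  product of submodules.\<close>

definition invertible_submodules :: "'a set \<Rightarrow> ('a, 'b) ring_scheme \<Rightarrow> 'a set monoid" where
  "invertible_submodules A R =
     \<lparr>carrier = {I. submodule_over A R I \<and> (\<exists>J. submodule_over A R J \<and> I \<cdot>\<^bsub>R\<^esub> J = A)},
      mult = (\<lambda>I J. I \<cdot>\<^bsub>R\<^esub> J),
      one = A\<rparr>"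

definition extension_map :: "'a set \<Rightarrow> 'a set \<Rightarrow> ('a, 'b) ring_scheme \<Rightarrow> 'a set \<Rightarrow> 'a set" where
  "extension_map A C R = (\<lambda>I\<in>carrier (invertible_submodules A R). I \<cdot>\<^bsub>R\<^esub> C)"

end

theory Submission
  imports Defs
begin

text \<open>
  An invertible \<open>C\<close>-submodule \<open>I\<close> with inverse \<open>J\<close> is described by finitely many \<open>x\<^sub>i \<in> I\<close>, \<open>y\<^sub>i \<in> J\<close>
  with \<open>\<Sum> x\<^sub>i y\<^sub>i = 1\<close>, and it descends to every subring containing all the products \<open>x\<^sub>i y\<^sub>j\<close>.
  These lie in the top of a finite chain of elementary subintegral extensions of \<open>A\<close>, so it
  suffices to descend along \<open>A \<subseteq> C = A[c] = A + Ac\<close> with \<open>c\<^sup>2\<close> and \<open>c\<^sup>3\<close> in \<open>A\<close>. There, \<open>c\<^sup>2C \<subseteq> A\<close>, and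
  one corrects \<open>x\<^sub>i\<close> and \<open>y\<^sub>j\<close> by elements of \<open>cI\<close> and \<open>cJ\<close> to get \<open>x'\<^sub>i y'\<^sub>j \<in> A\<close> for all \<open>i\<close>, \<open>j\<close>. Then
  \<open>I\<^sub>0 = \<Sum> Ax'\<^sub>i + c\<^sup>2I\<close> and \<open>J\<^sub>0 = \<Sum> Ay'\<^sub>j + c\<^sup>2J\<close> satisfy \<open>I\<^sub>0J\<^sub>0 \<subseteq> A\<close>, with equality since the ideal
  \<open>I\<^sub>0J\<^sub>0\<close> contains both \<open>\<Sum> x'\<^sub>i y'\<^sub>i = 1 + m\<close>, where \<open>m \<in> cC \<inter> A\<close>, and \<open>m\<^sup>4 \<in> c\<^sup>4C\<close>.
\<close>

context cring
begin

subsection \<open>Products of submodules\<close>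

text \<open>Closure under negation comes for free, because \<open>A\<close> contains the negative of
  \<open>\<one>\<close>; and \<open>module_of_ring R\<close> has the same additive group as
  \<open>R\<close>.\<close>

lemma submodule_over_iff:
  assumes A: "subring A R"
  shows "submodule_over A R I \<longleftrightarrow>
    I \<subseteq> carrier R \<and> \<zero> \<in> I \<and> (\<forall>x\<in>I. \<forall>y\<in>I. x \<oplus> y \<in> I) \<and> (\<forall>a\<in>A. \<forall>x\<in>I. a \<otimes> x \<in> I)"
    (is "_ \<longleftrightarrow> ?rhs")
proof -
  have eq: "subgroup I (add_monoid (module_of_ring R)) = subgroup I (add_monoid R)"
    by (simp add: module_of_ring_def subgroup_def m_inv_def)
  have "submodule_over A R I \<longleftrightarrow>
      subgroup I (add_monoid R) \<and> (\<forall>a\<in>A. \<forall>x\<in>I. a \<otimes> x \<in> I)"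
    unfolding submodule_def submodule_axioms_def eq by (auto simp: module_of_ring_def)
  also have "\<dots> \<longleftrightarrow> ?rhs"
  proof
    assume "subgroup I (add_monoid R) \<and> (\<forall>a\<in>A. \<forall>x\<in>I. a \<otimes> x \<in> I)"
    then show ?rhs
      using subgroup.subset[of I "add_monoid R"] subgroup.m_closed[of I "add_monoid R"]
        subgroup.one_closed[of I "add_monoid R"] by auto
  next
    assume rhs: ?rhs
    have "\<ominus> x \<in> I" if "x \<in> I" for x
    proof -
      have "\<ominus> \<one> \<otimes> x \<in> I"
        using rhs that subringE(3,5)[OF A] by blast
      then show ?thesis
        using that rhs l_minus[of \<one> x] by (auto simp: subset_iff)
    qed
    then have "subgroup I (add_monoid R)"
      using rhs by (intro add.subgroupI) auto
    then show "subgroup I (add_monoid R) \<and> (\<forall>a\<in>A. \<forall>x\<in>I. a \<otimes> x \<in> I)"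
      using rhs by blast
  qed
  finally show ?thesis .
qed

lemma submodule_overD:
  assumes "subring A R" "submodule_over A R I"
  shows "I \<subseteq> carrier R" "\<zero> \<in> I"
    and "\<And>x y. x \<in> I \<Longrightarrow> y \<in> I \<Longrightarrow> x \<oplus> y \<in> I"
    and "\<And>a x. a \<in> A \<Longrightarrow> x \<in> I \<Longrightarrow> a \<otimes> x \<in> I"
  using assms(2) unfolding submodule_over_iff[OF assms(1)] by auto

lemma submodule_over_subring:
  assumes "subring A R" "subring C R" "A \<subseteq> C" "submodule_over C R I"
  shows "submodule_over A R I"
  using assms(3,4) unfolding submodule_over_iff[OF assms(1)] submodule_over_iff[OF assms(2)]
  by blast

lemma submodule_over_self:
  assumes "subring A R"
  shows "submodule_over A R A"
  unfolding submodule_over_iff[OF assms] using subringE[OF assms] by blast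

lemma submodule_over_finsum_closed:
  assumes A: "subring A R" and I: "submodule_over A R I" and f: "\<And>i. i \<in> S \<Longrightarrow> f i \<in> I"
  shows "finsum R f S \<in> I"
  using f
proof (induction S rule: infinite_finite_induct)
  case (infinite S)
  then show ?case using submodule_overD(2)[OF A I] by simp
next
  case empty
  then show ?case using submodule_overD(2)[OF A I] by simp
next
  case (insert i S)
  have "f \<in> insert i S \<rightarrow> carrier R"
    using insert.prems submodule_overD(1)[OF A I] by blast
  then show ?case
    using insert submodule_overD(3)[OF A I] by (simp add: Pi_iff)
qed

lemma ideal_prod_subsetI:
  assumes "\<And>i j. i \<in> I \<Longrightarrow> j \<in> J \<Longrightarrow> i \<otimes> j \<in> K"
    and "\<And>x y. x \<in> K \<Longrightarrow> y \<in> K \<Longrightarrow> x \<oplus> y \<in> K"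
  shows "I \<cdot> J \<subseteq> K"
proof
  fix s assume "s \<in> I \<cdot> J"
  then show "s \<in> K" by induction (use assms in auto)
qed

lemma ideal_prod_subset_carrier:
  assumes "I \<subseteq> carrier R" "J \<subseteq> carrier R"
  shows "I \<cdot> J \<subseteq> carrier R"
  using assms by (intro ideal_prod_subsetI) auto

lemma ideal_prod_mono:
  assumes "I \<subseteq> I'" "J \<subseteq> J'"
  shows "I \<cdot> J \<subseteq> I' \<cdot> J'"
  using assms by (intro ideal_prod_subsetI) (auto intro: ideal_prod.intros)

lemma ideal_prod_commute:
  assumes "I \<subseteq> carrier R" "J \<subseteq> carrier R"
  shows "I \<cdot> J = J \<cdot> I"
proof -
  have "I \<cdot> J \<subseteq> J \<cdot> I" if "I \<subseteq> carrier R" "J \<subseteq> carrier R" for I J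
  proof (rule ideal_prod_subsetI)
    fix i j assume "i \<in> I" "j \<in> J"
    then show "i \<otimes> j \<in> J \<cdot> I"
      using that m_comm[of i j] ideal_prod.prod[of j J i I R] by (auto simp: subset_iff)
  qed (rule ideal_prod.sum)
  then show ?thesis using assms by blast
qed

lemma ideal_prod_assoc:
  assumes I: "I \<subseteq> carrier R" and J: "J \<subseteq> carrier R" and K: "K \<subseteq> carrier R"
  shows "I \<cdot> J \<cdot> K = I \<cdot> (J \<cdot> K)"
proof -
  have sub: "I \<cdot> J \<cdot> K \<subseteq> I \<cdot> (J \<cdot> K)"
    if I: "I \<subseteq> carrier R" and J: "J \<subseteq> carrier R" and K: "K \<subseteq> carrier R" for I J K
  proof (rule ideal_prod_subsetI)
    fix s k assume s: "s \<in> I \<cdot> J" and k: "k \<in> K"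
    from s show "s \<otimes> k \<in> I \<cdot> (J \<cdot> K)"
    proof induction
      case (prod i j)
      then have "i \<otimes> j \<otimes> k = i \<otimes> (j \<otimes> k)"
        using I J K k by (intro m_assoc) auto
      then show ?case
        using prod k by (auto intro: ideal_prod.prod)
    next
      case (sum s t)
      then have "(s \<oplus> t) \<otimes> k = s \<otimes> k \<oplus> t \<otimes> k"
        using ideal_prod_subset_carrier[OF I J] K k by (intro l_distr) auto
      then show ?case
        using sum by (auto intro: ideal_prod.sum)
    qed
  qed (rule ideal_prod.sum)
  \<comment> \<open>Commutativity turns the reverse inclusion into \<open>sub\<close> for the
    factors in the opposite order.\<close>
  have "I \<cdot> (J \<cdot> K) = K \<cdot> J \<cdot> I"
    using assms ideal_prod_subset_carrier by (metis ideal_prod_commute)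
  also have "\<dots> \<subseteq> K \<cdot> (J \<cdot> I)"
    by (rule sub[OF K J I])
  also have "\<dots> = I \<cdot> J \<cdot> K"
    using assms ideal_prod_subset_carrier by (metis ideal_prod_commute)
  finally show ?thesis using sub[OF I J K] by blast
qed

text \<open>With \<open>I = A\<close> this shows that \<open>A \<cdot> X\<close> is the span of an
  arbitrary nonempty set \<open>X\<close>. Nonemptiness puts \<open>\<zero>\<close> into the
  product, which contains no empty sum.\<close>

lemma submodule_over_ideal_prod:
  assumes A: "subring A R" and I: "submodule_over A R I"
    and X: "X \<subseteq> carrier R" "X \<noteq> {}"
  shows "submodule_over A R (I \<cdot> X)"
proof -
  note sm = submodule_overD[OF A I]
  obtain x where x: "x \<in> X" using X by blast
  have zero: "\<zero> \<in> I \<cdot> X"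
    using ideal_prod.prod[of \<zero> I x X R] sm(2) x X by auto
  have smult: "a \<otimes> s \<in> I \<cdot> X" if a: "a \<in> A" and s: "s \<in> I \<cdot> X" for a s
    using s
  proof induction
    case (prod i j)
    then have "a \<otimes> (i \<otimes> j) = a \<otimes> i \<otimes> j"
      using subringE(1)[OF A] sm(1) X a by (intro m_assoc[symmetric]) auto
    then show ?case
      using prod a sm(4) by (auto intro: ideal_prod.prod)
  next
    case (sum s t)
    then have "a \<otimes> (s \<oplus> t) = a \<otimes> s \<oplus> a \<otimes> t"
      using ideal_prod_subset_carrier[OF sm(1) X(1)] subringE(1)[OF A] a by (intro r_distr) auto
    then show ?case
      using sum by (auto intro: ideal_prod.sum)
  qed
  show ?thesis
    unfolding submodule_over_iff[OF A]
    using ideal_prod_subset_carrier[OF sm(1) X(1)] zero smult by (auto intro: ideal_prod.sum)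
qed

lemma ideal_prod_subring_left:
  assumes A: "subring A R" and I: "submodule_over A R I"
  shows "A \<cdot> I = I"
proof
  note sm = submodule_overD[OF A I]
  show "A \<cdot> I \<subseteq> I"
    by (intro ideal_prod_subsetI sm)
  show "I \<subseteq> A \<cdot> I"
  proof
    fix x assume "x \<in> I"
    then show "x \<in> A \<cdot> I"
      using ideal_prod.prod[of \<one> A x I R] subringE(3)[OF A] sm(1) by auto
  qed
qed

text \<open>This passes from the inductive product to indexed sums. The families are total with all
  values in \<open>I\<close> and \<open>J\<close>, so later steps need no bound on the
  index.\<close>

lemma mem_ideal_prod_finsum:
  assumes I: "I \<subseteq> carrier R" and J: "J \<subseteq> carrier R" and s: "s \<in> I \<cdot> J"
  obtains n :: nat and x y where
    "\<And>i. x i \<in> I" "\<And>i. y i \<in> J" "s = (\<Oplus>i\<in>{..<n}. x i \<otimes> y i)"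
proof -
  define rep where "rep s \<longleftrightarrow> (\<exists>(n::nat) x y. x \<in> UNIV \<rightarrow> I \<and> y \<in> UNIV \<rightarrow> J \<and>
    s = (\<Oplus>i\<in>{..<n}. x i \<otimes> y i))" for s
  have rep_carrier: "s \<in> carrier R" if "rep s" for s
    using that I J unfolding rep_def
    by (auto intro!: finsum_closed m_closed simp: Pi_iff subset_iff)
  \<comment> \<open>The induction runs over a stronger claim: adding \<open>s\<close> preserves
    representability. A product appends one term at index \<open>n\<close>, and a sum needs only
    associativity, never the concatenation of two families. Taking \<open>\<zero>\<close> for
    \<open>t\<close> recovers \<open>rep s\<close>.\<close>
  have rep_add: "\<forall>t. rep t \<longrightarrow> rep (s \<oplus> t)"
    using s
  proof induction
    case (prod i j)
    show ?case
    proof (intro allI impI)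
      fix t assume "rep t"
      then obtain n :: nat and x y where x: "x \<in> UNIV \<rightarrow> I" and y: "y \<in> UNIV \<rightarrow> J"
        and t: "t = (\<Oplus>i\<in>{..<n}. x i \<otimes> y i)"
        unfolding rep_def by blast
      define x' where "x' = x(n := i)"
      define y' where "y' = y(n := j)"
      have x': "x' \<in> UNIV \<rightarrow> I" and y': "y' \<in> UNIV \<rightarrow> J"
        using x y prod unfolding x'_def y'_def by auto
      have carr: "x' k \<otimes> y' k \<in> carrier R" for k
        using x' y' I J by (auto simp: Pi_iff subset_iff)
      have "(\<Oplus>k\<in>{..<Suc n}. x' k \<otimes> y' k) = x' n \<otimes> y' n \<oplus> (\<Oplus>k\<in>{..<n}. x' k \<otimes> y' k)"
        unfolding lessThan_Suc using carr by (intro finsum_insert) auto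
      also have "(\<Oplus>k\<in>{..<n}. x' k \<otimes> y' k) = t"
        unfolding t using x y I J by (intro finsum_cong') (auto simp: x'_def y'_def Pi_iff subset_iff)
      finally have "i \<otimes> j \<oplus> t = (\<Oplus>k\<in>{..<Suc n}. x' k \<otimes> y' k)"
        by (simp add: x'_def y'_def)
      with x' y' show "rep (i \<otimes> j \<oplus> t)"
        unfolding rep_def by blast
    qed
  next
    case (sum s1 s2)
    show ?case
    proof (intro allI impI)
      fix t assume t: "rep t"
      have "s1 \<oplus> s2 \<oplus> t = s1 \<oplus> (s2 \<oplus> t)"
        using sum.hyps ideal_prod_subset_carrier[OF I J] rep_carrier[OF t]
        by (intro a_assoc) auto
      then show "rep (s1 \<oplus> s2 \<oplus> t)"
        using sum.IH t by simp
    qed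
  qed
  \<comment> \<open>The empty sum represents \<open>\<zero>\<close>, but its total families still
    need values in \<open>I\<close> and \<open>J\<close>.\<close>
  have "I \<noteq> {} \<and> J \<noteq> {}"
    using s by induction auto
  then obtain i j where "i \<in> I" "j \<in> J" by blast
  then have "rep \<zero>"
    unfolding rep_def
    by (intro exI[of _ "0::nat"] exI[of _ "\<lambda>_. i"] exI[of _ "\<lambda>_. j"]) auto
  then have "rep (s \<oplus> \<zero>)"
    using rep_add by blast
  then have "rep s"
    using s ideal_prod_subset_carrier[OF I J] by (auto simp: subset_iff)
  then show ?thesis
    unfolding rep_def using that by (auto simp: Pi_iff)
qed

subsection \<open>Extension and descent of invertible submodules\<close>

lemma invertible_submodules_iff:
  "I \<in> carrier (invertible_submodules A R) \<longleftrightarrow>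
    submodule_over A R I \<and> (\<exists>J. submodule_over A R J \<and> I \<cdot> J = A)"
  by (simp add: invertible_submodules_def)

text \<open>If \<open>J\<close> is inverse to \<open>I\<close> over \<open>A\<close>, then CJ is
  inverse to IC over \<open>C\<close>, since (IC)(CJ) = (IJ)C = AC = C.\<close>

lemma invertible_submodules_extend:
  assumes A: "subring A R" and C: "subring C R" and AC: "A \<subseteq> C"
    and I: "I \<in> carrier (invertible_submodules A R)"
  shows "I \<cdot> C \<in> carrier (invertible_submodules C R)"
proof -
  obtain J where I: "submodule_over A R I" and J: "submodule_over A R J" and IJ: "I \<cdot> J = A"
    using I unfolding invertible_submodules_iff by blast
  have carr: "I \<subseteq> carrier R" "J \<subseteq> carrier R" "C \<subseteq> carrier R"
    using submodule_overD(1)[OF A I] submodule_overD(1)[OF A J] subringE(1)[OF C] by auto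
  have ne: "I \<noteq> {}" "J \<noteq> {}"
    using submodule_overD(2)[OF A I] submodule_overD(2)[OF A J] by auto
  have sub: "submodule_over C R (C \<cdot> I)" "submodule_over C R (C \<cdot> J)"
    using submodule_over_ideal_prod[OF C submodule_over_self[OF C]] carr ne by blast+
  have "I \<cdot> C \<cdot> (C \<cdot> J) = I \<cdot> (C \<cdot> C \<cdot> J)"
    using carr ideal_prod_subset_carrier by (simp add: ideal_prod_assoc)
  also have "C \<cdot> C = C"
    by (rule ideal_prod_subring_left[OF C submodule_over_self[OF C]])
  also have "I \<cdot> (C \<cdot> J) = A \<cdot> C"
    using carr by (simp add: ideal_prod_commute[of C J] ideal_prod_assoc[symmetric] IJ)
  also have "\<dots> = C"
    by (rule ideal_prod_subring_left[OF A submodule_over_subring[OF A C AC submodule_over_self[OF C]]])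
  finally show ?thesis
    unfolding invertible_submodules_iff using sub carr by (metis ideal_prod_commute)
qed

text \<open>The spans \<open>I0\<close> of \<open>X\<close> and \<open>J0\<close> of
  \<open>Y\<close> have product A(XY), an ideal of \<open>A\<close> containing
  \<open>\<one>\<close>, so they are mutually inverse. Moreover \<open>J0\<close> lies in
  \<open>J\<close>, hence I = I0(I J0) is contained in I0 C, while I0 C is contained in CI =
  I.\<close>

lemma invertible_submodules_descent:
  assumes A: "subring A R" and C: "subring C R" and AC: "A \<subseteq> C"
    and I: "submodule_over C R I" and J: "submodule_over C R J" and IJ: "I \<cdot> J = C"
    and X: "X \<subseteq> I" "X \<noteq> {}" and Y: "Y \<subseteq> J" "Y \<noteq> {}"
    and XY: "\<And>x y. x \<in> X \<Longrightarrow> y \<in> Y \<Longrightarrow> x \<otimes> y \<in> A"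
    and one: "\<one> \<in> A \<cdot> (X \<cdot> Y)"
  shows "\<exists>I\<^sub>0\<in>carrier (invertible_submodules A R). I\<^sub>0 \<cdot> C = I"
proof -
  have carr: "I \<subseteq> carrier R" "J \<subseteq> carrier R" "A \<subseteq> carrier R" "C \<subseteq> carrier R"
    using submodule_overD(1)[OF C I] submodule_overD(1)[OF C J] subringE(1)[OF C] AC by auto
  have carrX: "X \<subseteq> carrier R" "Y \<subseteq> carrier R"
    using X Y carr by auto
  have Asub: "submodule_over A R I" "submodule_over A R J"
    using submodule_over_subring[OF A C AC] I J by auto
  define I0 J0 where "I0 = A \<cdot> X" and "J0 = A \<cdot> Y"
  have I0: "submodule_over A R I0" and J0: "submodule_over A R J0"
    unfolding I0_def J0_def
    using submodule_over_ideal_prod[OF A submodule_over_self[OF A]] carrX X Y by blast+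
  have carr0: "I0 \<subseteq> carrier R" "J0 \<subseteq> carrier R"
    using submodule_overD(1)[OF A] I0 J0 by auto
  have I0I: "I0 \<subseteq> I"
    unfolding I0_def using ideal_prod_mono[OF order_refl X(1)] ideal_prod_subring_left[OF A Asub(1)]
    by blast
  have J0J: "J0 \<subseteq> J"
    unfolding J0_def using ideal_prod_mono[OF order_refl Y(1)] ideal_prod_subring_left[OF A Asub(2)]
    by blast
  have AA: "A \<cdot> A = A"
    by (rule ideal_prod_subring_left[OF A submodule_over_self[OF A]])
  have "I0 \<cdot> J0 = X \<cdot> (A \<cdot> A \<cdot> Y)"
    unfolding I0_def J0_def using carr carrX ideal_prod_subset_carrier
    by (simp add: ideal_prod_assoc ideal_prod_commute[of A X])
  also have "\<dots> = A \<cdot> (X \<cdot> Y)"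
    unfolding AA using carr carrX ideal_prod_subset_carrier
    by (simp add: ideal_prod_assoc[symmetric] ideal_prod_commute[of A X])
  finally have prod: "I0 \<cdot> J0 = A \<cdot> (X \<cdot> Y)" .
  have "X \<cdot> Y \<subseteq> A"
    using XY subringE(7)[OF A] by (intro ideal_prod_subsetI)
  then have "I0 \<cdot> J0 \<subseteq> A"
    unfolding prod using ideal_prod_mono[OF order_refl] AA by blast
  moreover have "A \<subseteq> I0 \<cdot> J0"
  proof
    fix a assume a: "a \<in> A"
    have "submodule_over A R (I0 \<cdot> J0)"
      using submodule_over_ideal_prod[OF A I0] carr0 submodule_overD(2)[OF A J0] by blast
    then have "a \<otimes> \<one> \<in> I0 \<cdot> J0"
      using submodule_overD(4)[OF A] a one prod by blast
    then show "a \<in> I0 \<cdot> J0"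
      using a carr by auto
  qed
  ultimately have inv: "I0 \<cdot> J0 = A" by blast
  have "I = A \<cdot> I"
    using ideal_prod_subring_left[OF A Asub(1)] by simp
  also have "\<dots> = I0 \<cdot> (I \<cdot> J0)"
    using carr carr0 by (simp add: inv[symmetric] ideal_prod_assoc ideal_prod_commute[of J0 I])
  also have "\<dots> \<subseteq> I0 \<cdot> C"
    using ideal_prod_mono[OF order_refl ideal_prod_mono[OF order_refl J0J], of I0 I] IJ by simp
  finally have "I \<subseteq> I0 \<cdot> C" .
  moreover have "I0 \<cdot> C \<subseteq> C \<cdot> I"
    using ideal_prod_mono[OF I0I order_refl, of C] carr by (metis ideal_prod_commute)
  ultimately have "I0 \<cdot> C = I"
    using ideal_prod_subring_left[OF C I] by blast
  moreover have "I0 \<in> carrier (invertible_submodules A R)"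
    unfolding invertible_submodules_iff using I0 J0 inv by blast
  ultimately show ?thesis ..
qed

subsection \<open>Elementary subintegral extensions\<close>

lemma submodule_over_cancel:
  assumes A: "subring A R" and I: "submodule_over A R I"
    and s: "s \<in> carrier R" and t: "t \<in> I" and st: "s \<oplus> t \<in> I"
  shows "s \<in> I"
proof -
  note sm = submodule_overD[OF A I]
  have ct: "t \<in> carrier R" using sm(1) t by blast
  have "\<ominus> \<one> \<otimes> t \<in> I"
    using sm(4) t subringE(3,5)[OF A] by blast
  then have "\<ominus> t \<in> I"
    using ct by (simp add: l_minus)
  then have "s \<oplus> t \<oplus> \<ominus> t \<in> I"
    using sm(3) st by blast
  then show ?thesis
    using s ct by (simp add: a_assoc r_neg)
qed

text \<open>Since c^2 lies in \<open>A\<close>, the set A + Ac is closed under multiplication. It is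
  thus a subring containing \<open>A\<close> and \<open>c\<close>, and so contains the ring they
  generate.\<close>

lemma elementary_subintegral_decomp:
  assumes A: "subring A R" and c: "c \<in> carrier R" and c2: "c \<otimes> c \<in> A"
    and d: "d \<in> generate_ring R (insert c A)"
  shows "\<exists>a\<in>A. \<exists>b\<in>A. d = a \<oplus> b \<otimes> c"
proof -
  note sr = subringE[OF A]
  have carr: "a \<in> carrier R" if "a \<in> A" for a
    using that sr(1) by blast
  define E where "E = {a \<oplus> b \<otimes> c | a b. a \<in> A \<and> b \<in> A}"
  have EI: "a \<oplus> b \<otimes> c \<in> E" if "a \<in> A" "b \<in> A" for a b
    using that unfolding E_def by blast
  have AE: "a \<in> E" if "a \<in> A" for a
    using EI[OF that sr(2)] c carr[OF that] by simp
  have "subring E R"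
  proof (rule subringI)
    show "E \<subseteq> carrier R"
      unfolding E_def using carr c by auto
    show "\<one> \<in> E"
      by (rule AE[OF sr(3)])
  next
    fix h assume "h \<in> E"
    then obtain a b where h: "a \<in> A" "b \<in> A" "h = a \<oplus> b \<otimes> c"
      unfolding E_def by blast
    have "\<ominus> (a \<oplus> b \<otimes> c) = \<ominus> a \<oplus> \<ominus> b \<otimes> c"
      using carr[OF h(1)] carr[OF h(2)] c by (simp add: minus_add l_minus)
    then show "\<ominus> h \<in> E"
      using EI[OF sr(5)[OF h(1)] sr(5)[OF h(2)]] h(3) by simp
  next
    fix h k assume "h \<in> E" "k \<in> E"
    then obtain a b a' b' where h: "a \<in> A" "b \<in> A" "h = a \<oplus> b \<otimes> c"
      and k: "a' \<in> A" "b' \<in> A" "k = a' \<oplus> b' \<otimes> c"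
      unfolding E_def by blast
    note cc = carr[OF h(1)] carr[OF h(2)] carr[OF k(1)] carr[OF k(2)] c
    have "(a \<oplus> b \<otimes> c) \<oplus> (a' \<oplus> b' \<otimes> c) = (a \<oplus> a') \<oplus> (b \<oplus> b') \<otimes> c"
      using cc by (simp add: l_distr a_ac)
    then show "h \<oplus> k \<in> E"
      using EI[OF sr(7)[OF h(1) k(1)] sr(7)[OF h(2) k(2)]] h(3) k(3) by simp
    have "(a \<oplus> b \<otimes> c) \<otimes> (a' \<oplus> b' \<otimes> c)
        = (a \<otimes> a' \<oplus> b \<otimes> b' \<otimes> (c \<otimes> c)) \<oplus> (a \<otimes> b' \<oplus> b \<otimes> a') \<otimes> c"
      using cc by (simp add: l_distr r_distr a_ac m_ac)
    moreover have "a \<otimes> a' \<oplus> b \<otimes> b' \<otimes> (c \<otimes> c) \<in> A" "a \<otimes> b' \<oplus> b \<otimes> a' \<in> A"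
      using h k c2 sr(6,7) by simp_all
    ultimately show "h \<otimes> k \<in> E"
      using EI h(3) k(3) by simp
  qed
  moreover have "c \<in> E"
    using EI[OF sr(2,3)] c by simp
  ultimately have "generate_ring R (insert c A) \<subseteq> E"
    using sr(1) c AE by (intro generate_ring_min_subring1) auto
  then show ?thesis
    using d unfolding E_def by blast
qed

lemma elementary_subintegral_descent:
  assumes elem: "elementary_subintegral R A C"
    and I: "submodule_over C R I" and J: "submodule_over C R J" and IJ: "I \<cdot> J = C"
  shows "\<exists>I\<^sub>0\<in>carrier (invertible_submodules A R). I\<^sub>0 \<cdot> C = I"
proof -
  from elem obtain c where A: "subring A R" and C: "subring C R" and AC: "A \<subseteq> C" and cC: "c \<in> C"
    and gen: "C = generate_ring R (insert c A)"
    and c2': "c [^] (2::nat) \<in> A" and c3': "c [^] (3::nat) \<in> A"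
    unfolding elementary_subintegral_def ring_extension_def by blast
  note srA = subringE[OF A] and srC = subringE[OF C]
  note smI = submodule_overD[OF C I] and smJ = submodule_overD[OF C J]
  have c: "c \<in> carrier R"
    using cC srC(1) by blast
  have c2: "c \<otimes> c \<in> A" and c3: "c \<otimes> c \<otimes> c \<in> A"
    using c2' c3' c by (simp_all add: numeral_2_eq_2 numeral_3_eq_3)
  have cA: "a \<in> carrier R" if "a \<in> A" for a using that srA(1) by blast
  have cCC: "a \<in> carrier R" if "a \<in> C" for a using that srC(1) by blast
  have cI: "a \<in> carrier R" if "a \<in> I" for a using that smI(1) by blast
  have cJ: "a \<in> carrier R" if "a \<in> J" for a using that smJ(1) by blast
  have prodC: "z \<otimes> w \<in> C" if "z \<in> I" "w \<in> J" for z w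
    using ideal_prod.prod[OF that, of R] IJ by simp
  \<comment> \<open>The coefficient of \<open>c\<close> is negated here, so that elements are moved
    into \<open>A\<close> by adding a multiple of \<open>c\<close>.\<close>
  have decomp: "\<exists>a b. a \<in> A \<and> b \<in> A \<and> d \<oplus> b \<otimes> c = a" if d: "d \<in> C" for d
  proof -
    obtain a b where ab: "a \<in> A" "b \<in> A" "d = a \<oplus> b \<otimes> c"
      using elementary_subintegral_decomp[OF A c c2] d gen by blast
    have "d \<oplus> \<ominus> b \<otimes> c = a"
      using ab cA c by (simp add: a_assoc l_minus r_neg)
    then show ?thesis using ab srA(5) by blast
  qed
  \<comment> \<open>That c^2 lies in the conductor of \<open>C\<close> in \<open>A\<close> is where
    c^3 enters: c^2(a + bc) = a c^2 + b c^3.\<close>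
  have cond: "c \<otimes> c \<otimes> d \<in> A" if d: "d \<in> C" for d
  proof -
    obtain a b where ab: "a \<in> A" "b \<in> A" "d = a \<oplus> b \<otimes> c"
      using elementary_subintegral_decomp[OF A c c2] d gen by blast
    have "c \<otimes> c \<otimes> (a \<oplus> b \<otimes> c) = a \<otimes> (c \<otimes> c) \<oplus> b \<otimes> (c \<otimes> c \<otimes> c)"
      using cA[OF ab(1)] cA[OF ab(2)] c by (simp add: r_distr m_ac)
    also have "\<dots> \<in> A"
      using ab c2 c3 srA(6,7) by simp
    finally show ?thesis using ab by simp
  qed

  have "\<one> \<in> I \<cdot> J" using srC(3) IJ by simp
  then obtain n :: nat and x y where x: "\<And>i. x i \<in> I" and y: "\<And>i. y i \<in> J"
    and one: "\<one> = (\<Oplus>i\<in>{..<n}. x i \<otimes> y i)"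
    using mem_ideal_prod_finsum[OF smI(1) smJ(1)] by metis
  have cx: "x i \<in> carrier R" and cy: "y i \<in> carrier R" for i
    using x y cI cJ by auto
  have "\<forall>i k. \<exists>a b. a \<in> A \<and> b \<in> A \<and> x i \<otimes> y k \<oplus> b \<otimes> c = a"
    using decomp prodC x y by blast
  then obtain a b where a: "\<And>i k. a i k \<in> A" and b: "\<And>i k. b i k \<in> A"
    and xy: "\<And>i k. x i \<otimes> y k \<oplus> b i k \<otimes> c = a i k"
    by metis
  have cb: "b i k \<in> carrier R" for i k
    using b cA by auto
  \<comment> \<open>In the matrix notation introduced below, \<open>w\<close> is Nx and
    \<open>v\<close> is yN. As the sum of the \<open>x k \<otimes> y k\<close> is
    \<open>\<one>\<close>, Px = x and yP = y; this is why x + cw = (P + cN)x, and likewise for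
    \<open>y\<close>.\<close>
  define w where "w i = (\<Oplus>k\<in>{..<n}. b i k \<otimes> x k)" for i
  define v where "v j = (\<Oplus>k\<in>{..<n}. b k j \<otimes> y k)" for j
  have w: "w i \<in> I" for i
    unfolding w_def using smI(4) b x AC by (intro submodule_over_finsum_closed[OF C I]) blast
  have v: "v j \<in> J" for j
    unfolding v_def using smJ(4) b y AC by (intro submodule_over_finsum_closed[OF C J]) blast
  have cw: "w i \<in> carrier R" and cv: "v i \<in> carrier R" for i
    using w v cI cJ by auto
  \<comment> \<open>With \<open>P = (x\<^sub>i y\<^sub>j)\<close>, \<open>P\<^sub>0 = (a\<^sub>i\<^sub>j)\<close> and \<open>N = (b\<^sub>i\<^sub>j)\<close> we have \<open>P = P\<^sub>0 - cN\<close> and \<open>P\<^sup>2 = P\<close>. The vectors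
    below are \<open>P\<^sub>0x\<close> and \<open>yP\<^sub>0\<close>, and \<open>P\<^sub>0PP\<^sub>0\<close> is congruent to \<open>P\<^sub>0\<^sup>2\<close> modulo \<open>c\<^sup>2\<close>, hence has entries
    in \<open>A\<close>.\<close>
  define x' where "x' i = x i \<oplus> c \<otimes> w i" for i
  define y' where "y' j = y j \<oplus> c \<otimes> v j" for j
  have x': "x' i \<in> I" and y': "y' i \<in> J" for i
    unfolding x'_def y'_def using x y w v cC by (simp_all add: smI(3,4) smJ(3,4))
  have x'y': "x' i \<otimes> y' j \<in> A" for i j
  proof -
    \<comment> \<open>These are the summands at \<open>k\<close> of three of the four terms in the
      expansion of \<open>x' i \<otimes> y' j\<close>. The fourth is a multiple of c^2 and lies in
      \<open>A\<close> by \<open>cond\<close>.\<close>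
    define g where "g k = (x i \<otimes> y k) \<otimes> (x k \<otimes> y j)" for k
    define h where "h k = c \<otimes> (b i k \<otimes> (x k \<otimes> y j))" for k
    define l where "l k = c \<otimes> (b k j \<otimes> (x i \<otimes> y k))" for k
    have cg: "g k \<in> carrier R" and ch: "h k \<in> carrier R" and cl: "l k \<in> carrier R" for k
      unfolding g_def h_def l_def using cx cy cb c by auto
    \<comment> \<open>Inserting the sum for \<open>\<one>\<close> between the factors makes this
      term a sum over \<open>k\<close> as well.\<close>
    have "x i \<otimes> y j = (x i \<otimes> \<one>) \<otimes> y j"
      using cx cy by simp
    also have "\<dots> = (\<Oplus>k\<in>{..<n}. x i \<otimes> (x k \<otimes> y k) \<otimes> y j)"
      unfolding one using cx cy by (simp add: finsum_rdistr finsum_ldistr Pi_iff)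
    also have "\<dots> = (\<Oplus>k\<in>{..<n}. g k)"
    proof (rule finsum_cong')
      fix k
      show "x i \<otimes> (x k \<otimes> y k) \<otimes> y j = g k"
        unfolding g_def using cx[of i] cx[of k] cy[of j] cy[of k] by (simp add: l_distr r_distr a_ac m_ac)
    qed (use cg in auto)
    finally have 1: "x i \<otimes> y j = (\<Oplus>k\<in>{..<n}. g k)" .
    have "c \<otimes> w i \<otimes> y j = (\<Oplus>k\<in>{..<n}. c \<otimes> (b i k \<otimes> x k) \<otimes> y j)"
      unfolding w_def using cx cy cb c by (simp add: finsum_rdistr finsum_ldistr Pi_iff)
    also have "\<dots> = (\<Oplus>k\<in>{..<n}. h k)"
    proof (rule finsum_cong')
      fix k
      show "c \<otimes> (b i k \<otimes> x k) \<otimes> y j = h k"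
        unfolding h_def using cx[of k] cy[of j] cb[of i k] c by (simp add: l_distr r_distr a_ac m_ac)
    qed (use ch in auto)
    finally have 2: "c \<otimes> w i \<otimes> y j = (\<Oplus>k\<in>{..<n}. h k)" .
    have "x i \<otimes> (c \<otimes> v j) = (\<Oplus>k\<in>{..<n}. x i \<otimes> (c \<otimes> (b k j \<otimes> y k)))"
      unfolding v_def using cx cy cb c by (simp add: finsum_rdistr Pi_iff)
    also have "\<dots> = (\<Oplus>k\<in>{..<n}. l k)"
    proof (rule finsum_cong')
      fix k
      show "x i \<otimes> (c \<otimes> (b k j \<otimes> y k)) = l k"
        unfolding l_def using cx[of i] cy[of k] cb[of k j] c by (simp add: l_distr r_distr a_ac m_ac)
    qed (use cl in auto)
    finally have 3: "x i \<otimes> (c \<otimes> v j) = (\<Oplus>k\<in>{..<n}. l k)" .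
    have "x i \<otimes> y j \<oplus> c \<otimes> w i \<otimes> y j \<oplus> x i \<otimes> (c \<otimes> v j) = (\<Oplus>k\<in>{..<n}. g k \<oplus> h k \<oplus> l k)"
      unfolding 1 2 3 using cg ch cl by (simp add: finsum_addf Pi_iff)
    also have "\<dots> \<in> A"
    proof (rule submodule_over_finsum_closed[OF A submodule_over_self[OF A]])
      fix k
      define q r where "q = x i \<otimes> y k" and "r = x k \<otimes> y j"
      have cqr: "q \<in> carrier R" "r \<in> carrier R"
        unfolding q_def r_def using cx cy by auto
      \<comment> \<open>Adding a multiple of c^2 by an element of \<open>A\<close> completes the
        summand to a product of two entries of the matrix \<open>a\<close>.\<close>
      have "g k \<oplus> h k \<oplus> l k \<oplus> b i k \<otimes> b k j \<otimes> (c \<otimes> c) = (q \<oplus> b i k \<otimes> c) \<otimes> (r \<oplus> b k j \<otimes> c)"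
        unfolding g_def h_def l_def q_def[symmetric] r_def[symmetric]
        using cqr cb[of i k] cb[of k j] c by (simp add: l_distr r_distr a_ac m_ac)
      also have "\<dots> = a i k \<otimes> a k j"
        unfolding q_def r_def xy ..
      finally have sum: "g k \<oplus> h k \<oplus> l k \<oplus> b i k \<otimes> b k j \<otimes> (c \<otimes> c) \<in> A"
        using srA(6)[OF a a] by simp
      have "g k \<oplus> h k \<oplus> l k \<in> carrier R"
        using cg ch cl by simp
      then show "g k \<oplus> h k \<oplus> l k \<in> A"
        using sum by (rule submodule_over_cancel[OF A submodule_over_self[OF A] _ srA(6)[OF srA(6)[OF b b] c2]])
    qed
    finally have 4: "x i \<otimes> y j \<oplus> c \<otimes> w i \<otimes> y j \<oplus> x i \<otimes> (c \<otimes> v j) \<in> A" .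
    have "x' i \<otimes> y' j = (x i \<otimes> y j \<oplus> c \<otimes> w i \<otimes> y j \<oplus> x i \<otimes> (c \<otimes> v j)) \<oplus> c \<otimes> c \<otimes> (w i \<otimes> v j)"
      unfolding x'_def y'_def using cx[of i] cy[of j] cw[of i] cv[of j] c by (simp add: l_distr r_distr a_ac m_ac)
    also have "\<dots> \<in> A"
      by (rule srA(7)[OF 4 cond[OF prodC[OF w v]]])
    finally show ?thesis .
  qed

  \<comment> \<open>Chosen so that \<open>x' i \<otimes> y' i\<close> is
    \<open>x i \<otimes> y i\<close> plus \<open>c \<otimes> f i\<close>. Summation gives u = 1 +
    ce, and m = ce lies in \<open>A\<close> because \<open>u\<close> does.\<close>
  define f where "f i = w i \<otimes> y i \<oplus> x i \<otimes> v i \<oplus> c \<otimes> (w i \<otimes> v i)" for i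
  have f: "f i \<in> C" for i
    unfolding f_def using x y w v cC by (simp add: prodC srC(6,7))
  have cf: "f i \<in> carrier R" for i
    by (rule cCC[OF f])
  define e where "e = (\<Oplus>i\<in>{..<n}. f i)"
  define u where "u = (\<Oplus>i\<in>{..<n}. x' i \<otimes> y' i)"
  have e: "e \<in> C"
    unfolding e_def using f
    by (intro submodule_over_finsum_closed[OF C submodule_over_self[OF C]])
  have ce: "e \<in> carrier R" by (rule cCC[OF e])
  have uA: "u \<in> A"
    unfolding u_def using x'y'
    by (intro submodule_over_finsum_closed[OF A submodule_over_self[OF A]])
  have u: "u = \<one> \<oplus> c \<otimes> e"
  proof -
    have "u = (\<Oplus>i\<in>{..<n}. x i \<otimes> y i \<oplus> c \<otimes> f i)"
      unfolding u_def
    proof (rule finsum_cong')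
      fix i
      show "x' i \<otimes> y' i = x i \<otimes> y i \<oplus> c \<otimes> f i"
        unfolding x'_def y'_def f_def using cx[of i] cy[of i] cw[of i] cv[of i] c by (simp add: l_distr r_distr a_ac m_ac)
    qed (use cx cy cf c in auto)
    also have "\<dots> = \<one> \<oplus> c \<otimes> e"
      unfolding one e_def using cx cy cf c by (simp add: finsum_addf finsum_rdistr Pi_iff)
    finally show ?thesis .
  qed
  define m where "m = c \<otimes> e"
  have cm: "m \<in> carrier R" unfolding m_def using c ce by simp
  have m: "m \<in> A"
  proof (rule submodule_over_cancel[OF A submodule_over_self[OF A] cm srA(3)])
    show "m \<oplus> \<one> \<in> A"
      using uA u c ce by (simp add: m_def a_comm)
  qed

  \<comment> \<open>The corrected families alone only yield \<open>u\<close>. Adjoining c^2 I and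
    c^2 J keeps all products in \<open>A\<close> by \<open>cond\<close> and supplies c^4 C. The full
    range of \<open>x'\<close> and \<open>y'\<close> is harmless, since \<open>x'y'\<close> holds
    for all indices.\<close>
  define X where "X = range x' \<union> (\<lambda>z. c \<otimes> c \<otimes> z) ` I"
  define Y where "Y = range y' \<union> (\<lambda>z. c \<otimes> c \<otimes> z) ` J"
  have ccC: "c \<otimes> c \<in> C" using c2 AC by blast
  have X: "X \<subseteq> I" "X \<noteq> {}" and Y: "Y \<subseteq> J" "Y \<noteq> {}"
    unfolding X_def Y_def using x' y' smI(4)[OF ccC] smJ(4)[OF ccC] by auto
  have cX: "X \<subseteq> carrier R" and cY: "Y \<subseteq> carrier R"
    using X Y smI(1) smJ(1) by auto
  have XY: "p \<otimes> q \<in> A" if p: "p \<in> X" and q: "q \<in> Y" for p q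
  proof -
    have pq: "p \<in> I" "q \<in> J" using p q X Y by auto
    from p consider (1) i where "p = x' i" | (2) z where "z \<in> I" "p = c \<otimes> c \<otimes> z"
      unfolding X_def by blast
    then show ?thesis
    proof cases
      case 1
      from q consider (1) j where "q = y' j" | (2) z where "z \<in> J" "q = c \<otimes> c \<otimes> z"
        unfolding Y_def by blast
      then show ?thesis
      proof cases
        case 1
        then show ?thesis using \<open>p = x' i\<close> x'y' by simp
      next
        case 2
        have "p \<otimes> q = c \<otimes> c \<otimes> (p \<otimes> z)"
          unfolding 2(2) using cI[OF pq(1)] cJ[OF 2(1)] c by (simp add: l_distr r_distr a_ac m_ac)
        then show ?thesis using cond prodC[OF pq(1) 2(1)] by simp
      qed
    next
      case 2
      have "p \<otimes> q = c \<otimes> c \<otimes> (z \<otimes> q)"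
        unfolding 2(2) using cI[OF 2(1)] cJ[OF pq(2)] c by (simp add: l_distr r_distr a_ac m_ac)
      then show ?thesis using cond prodC[OF 2(1) pq(2)] by simp
    qed
  qed
  have "X \<cdot> Y \<noteq> {}"
    using X Y ideal_prod.prod[of _ X _ Y R] by blast
  then have sm: "submodule_over A R (A \<cdot> (X \<cdot> Y))"
    using submodule_over_ideal_prod[OF A submodule_over_self[OF A]] ideal_prod_subset_carrier[OF cX cY]
    by blast
  note smXY = submodule_overD[OF A sm]
  have incl: "t \<in> A \<cdot> (X \<cdot> Y)" if "t \<in> X \<cdot> Y" for t
    using ideal_prod.prod[OF srA(3) that, of R] that ideal_prod_subset_carrier[OF cX cY] by auto
  have uXY: "u \<in> A \<cdot> (X \<cdot> Y)"
    unfolding u_def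
  proof (rule submodule_over_finsum_closed[OF A sm])
    show "x' i \<otimes> y' i \<in> A \<cdot> (X \<cdot> Y)" for i
      by (intro incl ideal_prod.prod) (auto simp: X_def Y_def)
  qed
  \<comment> \<open>Induction over C = IJ, with c^4 split evenly between the two factors of each
    product.\<close>
  have c4: "(c \<otimes> c) \<otimes> (c \<otimes> c) \<otimes> d \<in> X \<cdot> Y" if "d \<in> C" for d
    using that unfolding IJ[symmetric]
  proof induction
    case (prod i j)
    have "(c \<otimes> c) \<otimes> (c \<otimes> c) \<otimes> (i \<otimes> j) = (c \<otimes> c \<otimes> i) \<otimes> (c \<otimes> c \<otimes> j)"
      using cI[OF prod(1)] cJ[OF prod(2)] c by (simp add: l_distr r_distr a_ac m_ac)
    also have "\<dots> \<in> X \<cdot> Y"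
      using prod by (intro ideal_prod.prod) (auto simp: X_def Y_def)
    finally show ?case .
  next
    case (sum s t)
    have st: "s \<in> carrier R" "t \<in> carrier R"
      using sum.hyps cCC IJ by auto
    have "(c \<otimes> c) \<otimes> (c \<otimes> c) \<otimes> (s \<oplus> t)
        = (c \<otimes> c) \<otimes> (c \<otimes> c) \<otimes> s \<oplus> (c \<otimes> c) \<otimes> (c \<otimes> c) \<otimes> t"
      using st c by (simp add: l_distr r_distr a_ac m_ac)
    then show ?case
      using ideal_prod.sum[OF sum.IH] by simp
  qed
  have m4: "m \<otimes> (m \<otimes> (m \<otimes> m)) \<in> A \<cdot> (X \<cdot> Y)"
  proof -
    have "m \<otimes> (m \<otimes> (m \<otimes> m)) = (c \<otimes> c) \<otimes> (c \<otimes> c) \<otimes> (e \<otimes> e \<otimes> (e \<otimes> e))"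
      unfolding m_def using c ce by (simp add: m_ac)
    then show ?thesis
      using incl c4 e srC(6) by simp
  qed
  \<comment> \<open>As u = 1 + m is in the ideal, z = zu - mz is in it whenever mz is. Starting from
    m^4, this removes one factor \<open>m\<close> at a time until \<open>\<one>\<close> is
    reached.\<close>
  have step: "z \<in> A \<cdot> (X \<cdot> Y)" if z: "z \<in> A" and mz: "m \<otimes> z \<in> A \<cdot> (X \<cdot> Y)" for z
  proof (rule submodule_over_cancel[OF A sm cA[OF z] mz])
    have "z \<oplus> m \<otimes> z = z \<otimes> u"
      unfolding u m_def using cA[OF z] c ce by (simp add: r_distr m_ac)
    then show "z \<oplus> m \<otimes> z \<in> A \<cdot> (X \<cdot> Y)"
      using smXY(4)[OF z uXY] by simp
  qed
  have "m \<otimes> (m \<otimes> m) \<in> A \<cdot> (X \<cdot> Y)"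
    by (rule step[OF srA(6)[OF m srA(6)[OF m m]] m4])
  then have "m \<otimes> m \<in> A \<cdot> (X \<cdot> Y)"
    by (rule step[OF srA(6)[OF m m]])
  then have "m \<in> A \<cdot> (X \<cdot> Y)"
    by (rule step[OF m])
  then have "m \<otimes> \<one> \<in> A \<cdot> (X \<cdot> Y)"
    using cm by simp
  then have "\<one> \<in> A \<cdot> (X \<cdot> Y)"
    by (rule step[OF srA(3)])
  then show ?thesis
    by (intro invertible_submodules_descent[OF A C AC I J IJ X Y XY])
qed

subsection \<open>Chains of elementary subintegral extensions\<close>

text \<open>The chain is peeled off from the top: \<open>I\<close> descends along the last link from
  \<open>E\<close> to \<open>D\<close>, then by induction from \<open>D\<close> to \<open>A\<close>,
  and I0 D E = I0 E.\<close>

lemma elementary_chain_descent: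
  assumes "(elementary_subintegral R)\<^sup>*\<^sup>* A D" and A: "subring A R"
  shows "subring D R" "A \<subseteq> D"
    and "I \<in> carrier (invertible_submodules D R) \<Longrightarrow>
      \<exists>I\<^sub>0\<in>carrier (invertible_submodules A R). I\<^sub>0 \<cdot> D = I"
proof -
  have "subring D R \<and> A \<subseteq> D \<and> (\<forall>I\<in>carrier (invertible_submodules D R).
      \<exists>I\<^sub>0\<in>carrier (invertible_submodules A R). I\<^sub>0 \<cdot> D = I)"
    using assms(1)
  proof induction
    case base
    have "I \<cdot> A = I" if "I \<in> carrier (invertible_submodules A R)" for I
    proof -
      have I: "submodule_over A R I"
        using that unfolding invertible_submodules_iff by blast
      show ?thesis
        using ideal_prod_subring_left[OF A I] submodule_overD(1)[OF A I] subringE(1)[OF A]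
        by (simp add: ideal_prod_commute[of I A])
    qed
    then show ?case using A by blast
  next
    case (step D E)
    then have D: "subring D R" and E: "subring E R" and DE: "D \<subseteq> E" and AD: "A \<subseteq> D"
      unfolding elementary_subintegral_def ring_extension_def by auto
    have "\<exists>I\<^sub>0\<in>carrier (invertible_submodules A R). I\<^sub>0 \<cdot> E = I"
      if I: "I \<in> carrier (invertible_submodules E R)" for I
    proof -
      obtain J where "submodule_over E R I" "submodule_over E R J" "I \<cdot> J = E"
        using I unfolding invertible_submodules_iff by blast
      then obtain I1 where I1: "I1 \<in> carrier (invertible_submodules D R)" "I1 \<cdot> E = I"
        using elementary_subintegral_descent[OF step.hyps(2)] by blast
      then obtain I0 where I0: "I0 \<in> carrier (invertible_submodules A R)" "I0 \<cdot> D = I1"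
        using step.IH by blast
      have "I0 \<subseteq> carrier R"
        using I0(1) submodule_overD(1)[OF A] unfolding invertible_submodules_iff by blast
      then have "I0 \<cdot> D \<cdot> E = I0 \<cdot> (D \<cdot> E)"
        using subringE(1)[OF D] subringE(1)[OF E] by (intro ideal_prod_assoc)
      moreover have "D \<cdot> E = E"
        by (rule ideal_prod_subring_left[OF D submodule_over_subring[OF D E DE submodule_over_self[OF E]]])
      ultimately have "I0 \<cdot> E = I"
        using I0(2) I1(2) by simp
      then show ?thesis using I0(1) by blast
    qed
    then show ?case using E AD DE by blast
  qed
  then show "subring D R" "A \<subseteq> D"
    and "I \<in> carrier (invertible_submodules D R) \<Longrightarrow>
      \<exists>I\<^sub>0\<in>carrier (invertible_submodules A R). I\<^sub>0 \<cdot> D = I"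
    by blast+
qed

text \<open>The generators of the chain from \<open>A\<close> to \<open>E\<close> are adjoined to
  \<open>F\<close> one after another. Each link stays elementary, because the square and cube of its
  generator lie in the previous ring of the old chain, hence in the larger ring
  \<open>G\<close>.\<close>

lemma elementary_chain_join:
  assumes "(elementary_subintegral R)\<^sup>*\<^sup>* A E" and C: "subring C R" and "E \<subseteq> C"
    and F: "subring F R" "A \<subseteq> F" "F \<subseteq> C"
  shows "\<exists>G. (elementary_subintegral R)\<^sup>*\<^sup>* F G \<and> subring G R \<and> E \<subseteq> G \<and> G \<subseteq> C"
  using assms(1,3)
proof induction
  case base
  show ?case using F by blast
next
  case (step E E')
  then obtain e where E: "subring E R" and EE': "E \<subseteq> E'" and e: "e \<in> E'"
    and gen: "E' = generate_ring R (insert e E)"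
    and e2: "e [^] (2::nat) \<in> E" and e3: "e [^] (3::nat) \<in> E"
    unfolding elementary_subintegral_def ring_extension_def by blast
  obtain G where FG: "(elementary_subintegral R)\<^sup>*\<^sup>* F G" and G: "subring G R" "E \<subseteq> G" "G \<subseteq> C"
    using step EE' by blast
  define G' where "G' = generate_ring R (insert e G)"
  have carr: "insert e G \<subseteq> carrier R"
    using e step.prems G(3) subringE(1)[OF C] by blast
  have G': "subring G' R" "insert e G \<subseteq> G'"
    using generate_ringE(1,2)[OF carr G'_def] by auto
  have "G' \<subseteq> C"
    using generate_ringE(3)[OF carr G'_def C] e step.prems G(3) by blast
  moreover have "E' \<subseteq> G'"
    unfolding gen G'_def using G(2) carr by (intro mono_generate_ring) auto
  moreover have "elementary_subintegral R G G'"
    unfolding elementary_subintegral_def ring_extension_def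
    using G G' e2 e3 G'_def by blast
  ultimately show ?case
    using FG G'(1) by (meson rtranclp.rtrancl_into_rtrancl)
qed

text \<open>Subintegrality provides a separate chain for each element; the chain of each new element
  is stacked on the ring \<open>F\<close> already built, by
  \<open>elementary_chain_join\<close>.\<close>

lemma subintegral_finite_subset:
  assumes sub: "subintegral R A C" and "finite S" "S \<subseteq> C"
  shows "\<exists>D. (elementary_subintegral R)\<^sup>*\<^sup>* A D \<and> D \<subseteq> C \<and> S \<subseteq> D"
  using assms(2,3)
proof induction
  case empty
  have "A \<subseteq> C"
    using sub unfolding subintegral_def ring_extension_def by blast
  then show ?case by blast
next
  case (insert c S)
  have A: "subring A R" and C: "subring C R"
    using sub unfolding subintegral_def ring_extension_def by blast+
  obtain F where AF: "(elementary_subintegral R)\<^sup>*\<^sup>* A F" and F: "F \<subseteq> C" "S \<subseteq> F"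
    using insert by blast
  have "\<exists>(r::nat) D. D 0 = A \<and> (\<forall>i\<in>{1..r}. elementary_subintegral R (D (i - 1)) (D i)) \<and>
      ring_extension R (D r) C \<and> c \<in> D r"
    using sub insert.prems unfolding subintegral_def by blast
  then obtain r :: nat and D where D0: "D 0 = A"
    and D: "\<And>i. i \<in> {1..r} \<Longrightarrow> elementary_subintegral R (D (i - 1)) (D i)"
    and Dr: "D r \<subseteq> C" "c \<in> D r"
    unfolding ring_extension_def by blast
  have "(elementary_subintegral R)\<^sup>*\<^sup>* A (D i)" if "i \<le> r" for i
    using that
  proof (induction i)
    case 0
    then show ?case using D0 by simp
  next
    case (Suc i)
    then show ?case using D[of "Suc i"] by (auto intro: rtranclp.rtrancl_into_rtrancl)
  qed
  then obtain G where FG: "(elementary_subintegral R)\<^sup>*\<^sup>* F G" and G: "subring G R" "D r \<subseteq> G" "G \<subseteq> C"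
    using elementary_chain_join[OF _ C Dr(1) elementary_chain_descent(1,2)[OF AF A] F(1)] by blast
  have "insert c S \<subseteq> G"
    using F(2) Dr(2) G(2) elementary_chain_descent(2)[OF FG elementary_chain_descent(1)[OF AF A]]
    by blast
  then show ?case
    using AF FG G(3) by (meson rtranclp_trans)
qed

text \<open>Descent from \<open>C\<close> to a subring \<open>D\<close> only requires
  \<open>D\<close> to contain the finitely many products of the chosen \<open>x i\<close> and
  \<open>y j\<close>. Hence \<open>D\<close> can be the top of a finite chain over \<open>A\<close>,
  along which descent continues.\<close>

lemma subintegral_descent:
  assumes sub: "subintegral R A C" and I: "I \<in> carrier (invertible_submodules C R)"
  shows "\<exists>I\<^sub>0\<in>carrier (invertible_submodules A R). I\<^sub>0 \<cdot> C = I"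
proof -
  have A: "subring A R" and C: "subring C R"
    using sub unfolding subintegral_def ring_extension_def by blast+
  obtain J where I: "submodule_over C R I" and J: "submodule_over C R J" and IJ: "I \<cdot> J = C"
    using I unfolding invertible_submodules_iff by blast
  note smI = submodule_overD[OF C I] and smJ = submodule_overD[OF C J]
  have "\<one> \<in> I \<cdot> J"
    using subringE(3)[OF C] IJ by simp
  then obtain n :: nat and x y where x: "\<And>i. x i \<in> I" and y: "\<And>i. y i \<in> J"
    and one: "\<one> = (\<Oplus>i\<in>{..<n}. x i \<otimes> y i)"
    using mem_ideal_prod_finsum[OF smI(1) smJ(1)] by metis
  \<comment> \<open>Restricting to indices below \<open>n\<close> keeps the sets finite, and
    \<open>\<zero>\<close> keeps them nonempty when \<open>n\<close> is 0, which happens only in the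
    zero ring.\<close>
  define X Y where "X = insert \<zero> (x ` {..<n})" and "Y = insert \<zero> (y ` {..<n})"
  have X: "X \<subseteq> I" "X \<noteq> {}" and Y: "Y \<subseteq> J" "Y \<noteq> {}"
    unfolding X_def Y_def using x y smI(2) smJ(2) by auto
  have carr: "X \<subseteq> carrier R" "Y \<subseteq> carrier R"
    using X Y smI(1) smJ(1) by auto
  define S where "S = (\<lambda>(p, q). p \<otimes> q) ` (X \<times> Y)"
  have "S \<subseteq> I \<cdot> J"
    unfolding S_def using X Y by (auto intro: ideal_prod.prod)
  moreover have "finite S"
    unfolding S_def X_def Y_def by simp
  ultimately obtain D where AD: "(elementary_subintegral R)\<^sup>*\<^sup>* A D" and D: "D \<subseteq> C" "S \<subseteq> D"
    using subintegral_finite_subset[OF sub] IJ by metis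
  have sD: "subring D R"
    by (rule elementary_chain_descent(1)[OF AD A])
  have "X \<cdot> Y \<noteq> {}"
    using X Y ideal_prod.prod[of _ X _ Y R] by blast
  then have sm: "submodule_over D R (D \<cdot> (X \<cdot> Y))"
    using submodule_over_ideal_prod[OF sD submodule_over_self[OF sD]] ideal_prod_subset_carrier[OF carr]
    by blast
  have one_mem: "\<one> \<in> D \<cdot> (X \<cdot> Y)"
    unfolding one
  proof (rule submodule_over_finsum_closed[OF sD sm])
    fix i assume i: "i \<in> {..<n}"
    have "\<one> \<otimes> (x i \<otimes> y i) \<in> D \<cdot> (X \<cdot> Y)"
      using i subringE(3)[OF sD] by (intro ideal_prod.prod) (auto simp: X_def Y_def)
    moreover have "x i \<otimes> y i \<in> carrier R"
      using x y smI(1) smJ(1) by blast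
    ultimately show "x i \<otimes> y i \<in> D \<cdot> (X \<cdot> Y)" by simp
  qed
  have "p \<otimes> q \<in> D" if "p \<in> X" "q \<in> Y" for p q
    using that D(2) unfolding S_def by auto
  then obtain I1 where I1: "I1 \<in> carrier (invertible_submodules D R)" "I1 \<cdot> C = I"
    using invertible_submodules_descent[OF sD C D(1) I J IJ X Y _ one_mem] by blast
  then obtain I0 where I0: "I0 \<in> carrier (invertible_submodules A R)" "I0 \<cdot> D = I1"
    using elementary_chain_descent(3)[OF AD A] by blast
  have "I0 \<subseteq> carrier R"
    using I0(1) submodule_overD(1)[OF A] unfolding invertible_submodules_iff by blast
  then have "I0 \<cdot> D \<cdot> C = I0 \<cdot> (D \<cdot> C)"
    using subringE(1)[OF sD] subringE(1)[OF C] by (intro ideal_prod_assoc)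
  moreover have "D \<cdot> C = C"
    by (rule ideal_prod_subring_left[OF sD submodule_over_subring[OF sD C D(1) submodule_over_self[OF C]]])
  ultimately have "I0 \<cdot> C = I"
    using I0(2) I1(2) by simp
  then show ?thesis using I0(1) by blast
qed

end

theorem proposition3p1:
  fixes B :: "('a, 'b) ring_scheme" and A C :: "'a set"
  assumes "cring B"
    and "ring_extension B A (carrier B)"
    and "ring_extension B A C" and "ring_extension B C (carrier B)"
    and "subintegral B A C"
  shows "extension_map A C B ` carrier (invertible_submodules A B)
         = carrier (invertible_submodules C B)"
proof -
  interpret cring B by fact
  have A: "subring A B" and C: "subring C B" and AC: "A \<subseteq> C"
    using assms(3) unfolding ring_extension_def by auto
  have "extension_map A C B ` carrier (invertible_submodules A B)
      = (\<lambda>I. I \<cdot>\<^bsub>B\<^esub> C) ` carrier (invertible_submodules A B)"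
    unfolding extension_map_def by (intro image_cong) simp_all
  \<comment> \<open>Extension of inverses shows that the image lies in the target; descent provides
    the preimages.\<close>
  also have "\<dots> = carrier (invertible_submodules C B)"
    using invertible_submodules_extend[OF A C AC] subintegral_descent[OF assms(5)] by force
  finally show ?thesis .
qed

end
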